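(* There exists an infinite family of connected graphs, each equipped with an initial state of the rotor-router system (cyclic port orderings, initial pointers and initial token placement) using $k=2m$ tokens, such that for a graph of the family with $n$ vertices the periodicity of the initial state satisfies $t_p = 2^{\Omega(\sqrt{n \log n})}$.
   Context: Rotor-router model: $G=(V,E)$ is a finite connected undirected graph with $n$ vertices and $m$ edges; $\vec G=(V,\vec E)$ is obtained by replacing each edge $\{u,v\}$ by the two arcs $(u,v)$ and $(v,u)$; $\mathrm{out}(v)$ denotes the set of arcs leaving $v$. Each vertex $v$ has a fixed cyclic ordering $\rho_v$ of $\mathrm{out}(v)$, and $\mathit{next}(e)$ denotes the successor of $e\in\mathrm{out}(v)$ in $\rho_v$. A state at time $t$ is $\mathcal{S}_t=((\mathit{pointer}_v)_{v\in V},(\mathit{tokens}_v)_{v\in V})$ with $\mathit{pointer}_v\in\mathrm{out}(v)$ and $\mathit{tokens}_v\ge 0$ the number of (identical) tokens at $v$; $k$ is the total number of tokens. In each synchronous step, every vertex $v$, while it still has tokens, sends one token along $\mathit{pointer}_v$ and then sets $\mathit{pointer}_v:=\mathit{next}(\mathit{pointer}_v)$; all tokens sent in a step arrive at the heads of their arcs at the next time step. A state $\mathcal{S}_t$ is stable if $\mathcal{S}_{t'}=\mathcal{S}_t$ for some $t'>t$. The stabilization time $t_s$ of $\mathcal{S}_0$ is the smallest $t$ such that $\mathcal{S}_t$ is stable, and the periodicity $t_p$ of $\mathcal{S}_0$ is the smallest $t_p>0$ with $\mathcal{S}_{t_s}=\mathcal{S}_{t_s+t_p}$. *)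

theory Defs
  imports
    "Graph_Theory.Digraph_Component"
    "HOL-Combinatorics.Orbits"
    "HOL-Library.FuncSet"
    "HOL-Library.Landau_Symbols"
begin

record 'a state =
  pointer :: "'a \<Rightarrow> 'a \<times> 'a"
  tokens :: "'a \<Rightarrow> nat"

definition bidirect :: "'a set \<Rightarrow> 'a set set \<Rightarrow> ('a, 'a \<times> 'a) pre_digraph" where
  "bidirect V E = with_proj \<lparr> pverts = V, parcs = {(u, v). {u, v} \<in> E} \<rparr>"

text \<open>
  An arc determines its tail, so a single map \<open>nxt\<close> carries the cyclic orderings of all
  vertices. The predicate \<^const>\<open>cyclic_on\<close> says that \<open>nxt\<close> permutes the arcs leaving \<open>v\<close>
  in a single cycle; in particular every vertex has at least one outgoing arc.
\<close>

locale rotor_router =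
  fixes V :: "'a set" and E :: "'a set set" and nxt :: "'a \<times> 'a \<Rightarrow> 'a \<times> 'a"
  assumes finite_V: "finite V"
    and E_edges: "E \<subseteq> {{u, v} | u v. u \<in> V \<and> v \<in> V \<and> u \<noteq> v}"
    and connected_G: "connected (bidirect V E)"
    and nxt_cyclic: "\<And>v. v \<in> V \<Longrightarrow> cyclic_on nxt (out_arcs (bidirect V E) v)"
begin

abbreviation out :: "'a \<Rightarrow> ('a \<times> 'a) set" where
  "out v \<equiv> out_arcs (bidirect V E) v"

text \<open>
  States are families indexed by \<open>V\<close>. They are represented by functions that are
  \<^const>\<open>undefined\<close> outside \<open>V\<close>, so that HOL equality is equality of states.
\<close>

definition states :: "'a state set" where
  "states = {S. pointer S \<in> (\<Pi>\<^sub>E v\<in>V. out v) \<and> tokens S \<in> extensional V}"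

definition total_tokens :: "'a state \<Rightarrow> nat" where
  "total_tokens S = (\<Sum>v\<in>V. tokens S v)"

text \<open>
  The \<open>i\<close>-th token (counting from 0) sent by \<open>v\<close> within one step leaves along the
  \<open>i\<close>-fold successor of the pointer that \<open>v\<close> has at the start of the step.
\<close>

definition sent :: "'a state \<Rightarrow> 'a \<times> 'a \<Rightarrow> nat" where
  "sent S e = card {i. i < tokens S (fst e) \<and> (nxt ^^ i) (pointer S (fst e)) = e}"

definition step :: "'a state \<Rightarrow> 'a state" where
  "step S =
    \<lparr> pointer = (\<lambda>v\<in>V. (nxt ^^ tokens S v) (pointer S v)),
      tokens = (\<lambda>v\<in>V. \<Sum>e\<in>in_arcs (bidirect V E) v. sent S e) \<rparr>"

definition state_at :: "'a state \<Rightarrow> nat \<Rightarrow> 'a state" where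
  "state_at S t = (step ^^ t) S"

definition stable :: "'a state \<Rightarrow> nat \<Rightarrow> bool" where
  "stable S t \<longleftrightarrow> (\<exists>t'>t. state_at S t' = state_at S t)"

definition stabilization_time :: "'a state \<Rightarrow> nat" where
  "stabilization_time S = (LEAST t. stable S t)"

definition periodicity :: "'a state \<Rightarrow> nat" where
  "periodicity S = (LEAST p. p > 0 \<and>
     state_at S (stabilization_time S) = state_at S (stabilization_time S + p))"

end

end

theory Submission
  imports Defs "HOL-Computational_Algebra.Primes" "HOL-Library.Nat_Bijection"
begin

text \<open>
  If every vertex \<open>v\<close> holds \<open>deg v\<close> tokens, then one token crosses each arc per step and nothing
  changes. Perturb this state along disjoint directed cycles: on each cycle add a token at
  one vertex and remove one at its predecessor, with the pointers of the cycle set so that the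
  surplus and the deficit both travel along the cycle. As the surplus advances each pointer
  once and the deficit then restores it, the rest of the graph never notices. Hence a cycle of
  length \<open>q\<close> recurs exactly after multiples of \<open>q\<close> steps, however the cycles are joined into a
  connected graph; here a hub adjacent to all other vertices is used.

  As lengths take the largest powers \<open>\<le> x\<close> of all primes \<open>p \<le> x\<close>, so that the period is
  a multiple of \<open>Lcm {1..x}\<close>.
\<close>

section \<open>The least common multiple of an initial segment\<close>

text \<open>
  With \<open>a(m,k) = 1 / ((m+1) (m choose k))\<close>, the entries of Leibniz's harmonic triangle satisfy
  \<open>a(m+1,k+1) = a(m,k) - a(m+1,k)\<close>, so multiplying by \<open>Lcm {1..x}\<close> clears all their denominators.
\<close>

lemma leibniz_triangle_dvd_Lcm:
  fixes k m x :: nat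
  assumes "k \<le> m" "m < x"
  shows "Suc m * (m choose k) dvd Lcm {1..x}"
proof -
  define L where "L = Lcm {1..x}"
  have "real L / real (Suc m * (m choose k)) \<in> \<int>"
    using assms
  proof (induction k arbitrary: m)
    case 0
    then have "Suc m dvd L" unfolding L_def by (intro dvd_Lcm) auto
    then obtain a where "L = Suc m * a" by (elim dvdE)
    then have "real L / real (Suc m * (m choose 0)) = real a"
      by (simp add: field_simps)
    then show ?case by simp
  next
    case (Suc k)
    then obtain n where m: "m = Suc n" "k \<le> n" by (cases m) auto
    \<comment> \<open>Both neighbouring binomials are rational multiples of \<open>c\<close>, so the
      recurrence of the triangle becomes an identity of rational functions.\<close>
    define c where "c = real (n choose k)"
    have c: "c > 0" using m by (simp add: c_def)
    have "(Suc n choose Suc k) * Suc k = Suc n * (n choose k)"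
      by (metis Suc_times_binomial_eq)
    then have 1: "real (Suc n choose Suc k) = (n + 1) * c / (k + 1)"
      unfolding c_def by (metis (no_types, lifting) Suc_eq_plus1 nonzero_eq_divide_eq of_nat_0_eq_iff of_nat_mult old.nat.distinct(2))
    have "(Suc n - k) * (Suc n choose k) = Suc n * (n choose k)"
      using binomial_absorb_comp[of "Suc n" k] by simp
    then have "real (Suc n - k) * real (Suc n choose k) = real (Suc n) * c"
      unfolding c_def by (metis of_nat_mult)
    then have 2: "real (Suc n choose k) = (n + 1) * c / (n + 1 - k)"
      using m(2) by (simp add: field_simps of_nat_diff Suc_diff_le)
    have nk: "real n + 1 - real k > 0" using m by simp
    have "real L / real (Suc m * (m choose Suc k))
        = real L / real (Suc n * (n choose k)) - real L / real (Suc m * (m choose k))"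
      unfolding m(1) of_nat_mult 1 2 c_def[symmetric] using c nk
      by (simp add: divide_simps) (simp add: algebra_simps)
    moreover have "real L / real (Suc n * (n choose k)) \<in> \<int>" "real L / real (Suc m * (m choose k)) \<in> \<int>"
      using Suc.prems m by (intro Suc.IH; simp)+
    ultimately show ?case by simp
  qed
  then obtain z where z: "real L / real (Suc m * (m choose k)) = of_int z" by (elim Ints_cases)
  have "real L = of_int z * real (Suc m * (m choose k))"
  proof -
    have "real (Suc m * (m choose k)) \<noteq> 0"
      using assms by (simp only: of_nat_eq_0_iff) simp
    then show ?thesis using z by (metis nonzero_eq_divide_eq)
  qed
  then have "int L = z * int (Suc m * (m choose k))"
    by (metis of_int_eq_iff of_int_mult of_int_of_nat_eq)
  then show ?thesis unfolding L_def[symmetric]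
    by (metis dvd_triv_right int_dvd_int_iff)
qed

lemma Lcm_atLeastAtMost_pos: "Lcm {1..x::nat} > 0"
  by (intro Nat.gr0I) (simp add: Lcm_0_iff)

text \<open>The middle entry of row \<open>2 * m\<close> alone supplies a divisor of size at least
  \<open>4 ^ m\<close>. The largest even row index below \<open>x\<close> is \<open>x - 1\<close> or
  \<open>x - 2\<close>, whence the exponent.\<close>

lemma Lcm_atLeastAtMost_ge:
  fixes x :: nat
  assumes "x > 0"
  shows "2 ^ (x - 2) \<le> Lcm {1..x}"
proof -
  define m where "m = (x - 1) div 2"
  have "(4::real) ^ m \<le> real (Suc (2 * m) * (2 * m choose m))"
  proof (cases "m = 0")
    case False
    then have "4 ^ m \<le> 2 * m * real (2 * m choose m)"
      using central_binomial_lower_bound[of m] by (simp add: field_simps)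
    also have "\<dots> \<le> real (Suc (2 * m) * (2 * m choose m))" by (simp add: algebra_simps)
    finally show ?thesis .
  qed simp
  then have "4 ^ m \<le> Suc (2 * m) * (2 * m choose m)"
    by (metis of_nat_le_iff of_nat_numeral of_nat_power)
  also have "\<dots> \<le> Lcm {1..x}"
  proof (rule dvd_imp_le[OF leibniz_triangle_dvd_Lcm Lcm_atLeastAtMost_pos])
    show "2 * m < x" using assms unfolding m_def by presburger
  qed simp
  finally have "2 ^ (2 * m) \<le> Lcm {1..x}" by (simp add: power_mult)
  moreover have "(2::nat) ^ (x - 2) \<le> 2 ^ (2 * m)"
    by (intro power_increasing) (auto simp: m_def)
  ultimately show ?thesis by linarith
qed

section \<open>Prime powers in the least common multiple\<close>

text \<open>The multiplicity of a prime in an lcm is the larger of the two multiplicities, so a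
  prime power dividing \<open>Lcm {1..x}\<close> already divides a single number up to
  \<open>x\<close>.\<close>

lemma prime_power_dvd_Lcm_atLeastAtMost:
  fixes p x :: nat
  assumes "prime p" "x > 0" "p ^ k dvd Lcm {1..x}"
  shows "p ^ k \<le> x"
  using assms(2,3)
proof (induction x)
  case (Suc x)
  have eq: "Lcm {1..Suc x} = lcm (Suc x) (Lcm {1..x})"
    by (simp add: atLeastAtMostSuc_conv)
  have "multiplicity p (lcm (Suc x) (Lcm {1..x})) = max (multiplicity p (Suc x)) (multiplicity p (Lcm {1..x}))"
    using Lcm_atLeastAtMost_pos[of x] assms(1) by (intro multiplicity_lcm) auto
  moreover have "k \<le> multiplicity p (lcm (Suc x) (Lcm {1..x}))"
    using Suc.prems(2) Lcm_atLeastAtMost_pos[of x] assms(1) unfolding eq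
    by (subst (asm) power_dvd_iff_le_multiplicity) (auto simp: lcm_eq_0_iff)
  ultimately have "k \<le> multiplicity p (Suc x) \<or> k \<le> multiplicity p (Lcm {1..x})" by auto
  then have *: "p ^ k dvd Suc x \<or> p ^ k dvd Lcm {1..x}"
    by (metis multiplicity_dvd')
  show ?case
  \<comment> \<open>The induction hypothesis needs a positive bound; for \<open>x = 0\<close> the
    least common multiple is 1.\<close>
  proof (cases "x = 0")
    case True
    then show ?thesis using * by auto
  next
    case False
    then show ?thesis using * Suc.IH by (auto dest: dvd_imp_le)
  qed
qed simp

text \<open>For a prime \<open>p \<le> x\<close> this is the largest power of \<open>p\<close> not
  exceeding \<open>x\<close>. Taking the exponent as a multiplicity makes the factorization of
  \<open>Lcm {1..x}\<close> immediate.\<close>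

definition lcm_prime_power :: "nat \<Rightarrow> nat \<Rightarrow> nat" where
  "lcm_prime_power x p = p ^ multiplicity p (Lcm {1..x})"

lemma prime_factors_Lcm_atLeastAtMost:
  "prime_factors (Lcm {1..x::nat}) = {p. prime p \<and> p \<le> x}"
proof (intro set_eqI iffI)
  fix p assume "p \<in> prime_factors (Lcm {1..x})"
  then have p: "prime p" "p dvd Lcm {1..x}" by (auto simp: in_prime_factors_iff)
  then have "x > 0" by (intro Nat.gr0I) (auto)
  then show "p \<in> {p. prime p \<and> p \<le> x}"
    using prime_power_dvd_Lcm_atLeastAtMost[of p x 1] p by simp
next
  fix p assume "p \<in> {p. prime p \<and> p \<le> x}"
  then show "p \<in> prime_factors (Lcm {1..x})"
    using Lcm_atLeastAtMost_pos[of x] 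
    by (auto simp: in_prime_factors_iff prime_gt_0_nat Suc_le_eq intro!: dvd_Lcm)
qed

text \<open>The last bound is maximality: otherwise the next power of \<open>p\<close> would lie in
  \<open>{1..x}\<close> and divide the least common multiple, against the choice of the
  exponent.\<close>

lemma lcm_prime_power_bounds:
  assumes "prime p" "p \<le> x"
  shows "p \<le> lcm_prime_power x p" "lcm_prime_power x p \<le> x" "x < p * lcm_prime_power x p"
proof -
  let ?k = "multiplicity p (Lcm {1..x})"
  have x: "x > 0" using assms prime_gt_0_nat[of p] by linarith
  have "p dvd Lcm {1..x}" using assms by (intro dvd_Lcm) (auto simp: prime_gt_0_nat Suc_le_eq)
  then have "?k \<noteq> 0"
    using assms(1) Lcm_atLeastAtMost_pos[of x] by (simp add: prime_multiplicity_gt_zero_iff)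
  then show "p \<le> lcm_prime_power x p"
    unfolding lcm_prime_power_def using assms(1) by (intro self_le_power) (auto simp: prime_gt_0_nat Suc_le_eq)
  show "lcm_prime_power x p \<le> x" unfolding lcm_prime_power_def
    by (intro prime_power_dvd_Lcm_atLeastAtMost assms x multiplicity_dvd)
  show "x < p * lcm_prime_power x p"
  proof (rule ccontr)
    assume "\<not> ?thesis"
    then have "p ^ Suc ?k \<in> {1..x}" 
      using assms(1) by (auto simp: lcm_prime_power_def Suc_le_eq prime_gt_0_nat)
    then have "p ^ Suc ?k dvd Lcm {1..x}" by (rule dvd_Lcm)
    then have "Suc ?k \<le> ?k"
      using assms(1) Lcm_atLeastAtMost_pos[of x]
      by (subst (asm) power_dvd_iff_le_multiplicity) auto
    then show False by simp
  qed
qed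

lemma prod_lcm_prime_power: "(\<Prod>p | prime p \<and> p \<le> x. lcm_prime_power x p) = Lcm {1..x}"
  using prod_prime_factors[of "Lcm {1..x}"] Lcm_atLeastAtMost_pos[of x]
  unfolding lcm_prime_power_def prime_factors_Lcm_atLeastAtMost by simp

text \<open>Divisibility is compared prime by prime; primes above \<open>x\<close> have multiplicity
  0 in the least common multiple.\<close>

lemma Lcm_atLeastAtMost_dvdI:
  assumes "\<And>p. prime p \<Longrightarrow> p \<le> x \<Longrightarrow> lcm_prime_power x p dvd P" "P > 0"
  shows "Lcm {1..x} dvd P"
proof (rule multiplicity_le_imp_dvd)
  fix p :: nat assume p: "prime p"
  show "multiplicity p (Lcm {1..x}) \<le> multiplicity p P"
  proof (cases "p \<le> x")
    case True
    then show ?thesis using assms p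
      by (intro multiplicity_geI) (auto simp: lcm_prime_power_def)
  next
    case False
    then have "p \<notin> prime_factors (Lcm {1..x})"
      unfolding prime_factors_Lcm_atLeastAtMost by simp
    then have "\<not> p dvd Lcm {1..x}" 
      using p Lcm_atLeastAtMost_pos[of x] by (auto simp: in_prime_factors_iff)
    then show ?thesis by (simp add: not_dvd_imp_multiplicity_0)
  qed
qed (use assms Lcm_atLeastAtMost_pos in auto)

text \<open>Each maximal prime power \<open>q\<close> of a prime \<open>p\<close> satisfies
  \<open>x < p * q\<close> and \<open>p \<le> q\<close>, so its square exceeds \<open>x\<close>; the
  product of these powers is the least common multiple.\<close>

lemma power_card_primes_le_Lcm_square:
  fixes x :: nat
  shows "x ^ card {p. prime p \<and> p \<le> x} \<le> (Lcm {1..x})\<^sup>2"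
proof -
  have "x ^ card {p. prime p \<and> p \<le> x} = (\<Prod>p | prime p \<and> p \<le> x. x)" by simp
  also have "\<dots> \<le> (\<Prod>p | prime p \<and> p \<le> x. (lcm_prime_power x p)\<^sup>2)"
  proof (intro prod_mono conjI)
    fix p assume "p \<in> {p. prime p \<and> p \<le> x}"
    then have "p * lcm_prime_power x p \<le> (lcm_prime_power x p)\<^sup>2" "x < p * lcm_prime_power x p"
      using lcm_prime_power_bounds[of p x] by (auto simp: power2_eq_square)
    then show "x \<le> (lcm_prime_power x p)\<^sup>2" by linarith
  qed simp
  also have "\<dots> = (Lcm {1..x})\<^sup>2"
    by (simp add: prod_power_distrib[symmetric] prod_lcm_prime_power)
  finally show ?thesis .
qed

section \<open>Logarithmic estimate in the number of vertices\<close>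

text \<open>
  For \<open>L = Lcm {1..x}\<close> and \<open>r\<close> the number of primes up to \<open>x\<close>, both \<open>log L \<ge> x / 2\<close> and
  \<open>log L \<ge> r log x / 2\<close> hold. Their product is of order \<open>n log n\<close> as \<open>n \<le> 1 + r x\<close>,
  so no upper bound on \<open>r\<close> is needed.
\<close>

lemma log_Lcm_atLeastAtMost_ge:
  fixes x n :: nat
  assumes x: "x \<ge> 4" and n: "n = Suc (\<Sum>p | prime p \<and> p \<le> x. lcm_prime_power x p)"
  shows "sqrt (real n * ln (real n)) \<le> 5 * log 2 (real (Lcm {1..x}))"
proof -
  define r where "r = card {p. prime p \<and> p \<le> x}"
  define l where "l = log 2 (real (Lcm {1..x}))"
  have L: "real (Lcm {1..x}) > 0" using Lcm_atLeastAtMost_pos[of x] by simp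
  have "2 ^ (x - 2) \<le> Lcm {1..x}" using x by (intro Lcm_atLeastAtMost_ge) simp
  then have "real (2 ^ (x - 2)) \<le> real (Lcm {1..x})" by (simp only: of_nat_le_iff)
  then have "real (x - 2) \<le> l" unfolding l_def using L
    by (subst le_log_iff) (auto simp: powr_realpow)
  \<comment> \<open>\<open>x - 2\<close> is at least \<open>x / 2\<close> because
    \<open>x \<ge> 4\<close>.\<close>
  then have l1: "real x / 2 \<le> l" using x by linarith
  have "real (x ^ r) \<le> real ((Lcm {1..x})\<^sup>2)"
    unfolding r_def by (simp only: of_nat_le_iff power_card_primes_le_Lcm_square)
  then have "log 2 (real x ^ r) \<le> log 2 (real (Lcm {1..x}) ^ 2)"
    using x L by (subst log_le_cancel_iff) auto
  then have l2: "real r * log 2 (real x) \<le> 2 * l"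
    using x L by (simp add: log_nat_power l_def)
  have lnx: "ln (real x) > 0" using x by simp
  have "ln 2 \<le> (1::real)" using ln_le_minus_one[of "2::real"] by simp
  then have "ln (real x) \<le> log 2 (real x)" 
    using lnx by (simp add: log_def field_simps mult_left_le)
  then have l3: "real r * ln (real x) \<le> 2 * l"
    using l2 by (meson mult_left_mono of_nat_0_le_iff order_trans)
  have "(\<Sum>p | prime p \<and> p \<le> x. lcm_prime_power x p) \<le> of_nat (card {p. prime p \<and> p \<le> x}) * x"
    by (intro sum_bounded_above) (auto intro: lcm_prime_power_bounds)
  then have n_le: "n \<le> 1 + r * x" by (simp add: n r_def)
  have "card {2::nat} \<le> r" unfolding r_def using x by (intro card_mono) auto
  then have r1: "1 \<le> r" by simp
  have "{p. prime p \<and> p \<le> x} \<subseteq> {1..x}" by (auto simp: Suc_le_eq prime_gt_0_nat)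
  then have rx: "r \<le> x" unfolding r_def using card_mono[of "{1..x}"] by simp
  have n1: "n \<ge> 1" using n by simp
  have nr: "n \<le> 2 * (r * x)"
  proof -
    have "1 \<le> r * x" using r1 x by (simp add: Suc_le_eq)
    then show ?thesis using n_le by linarith
  qed
  \<comment> \<open>The cubic bound on \<open>n\<close> enters only through \<open>ln n\<close>, so
    its crudeness costs just a factor 3.\<close>
  have "2 * (r * x) \<le> x * (x * x)" using x rx by (intro mult_mono) auto
  then have "n \<le> x ^ 3" using nr by (simp only: power3_eq_cube mult.assoc order_trans)
  then have "real n \<le> real x ^ 3" by (metis of_nat_le_iff of_nat_power)
  then have "ln (real n) \<le> ln (real x ^ 3)" using n1 x by (subst ln_le_cancel_iff) auto
  then have lnn: "ln (real n) \<le> 3 * ln (real x)" using x by (simp add: ln_realpow)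
  have "real n * ln (real n) \<le> (2 * (real r * real x)) * (3 * ln (real x))"
    using nr n1 lnn by (intro mult_mono) (auto simp flip: of_nat_mult)
  \<comment> \<open>The factors are grouped to match \<open>l1\<close> and \<open>l3\<close>. The
    result \<open>24 * l\<^sup>2\<close> is below \<open>(5 * l)\<^sup>2\<close>, the origin of the
    constant 5.\<close>
  also have "\<dots> = 12 * ((real x / 2) * (real r * ln (real x)))" by simp
  also have "\<dots> \<le> 12 * (l * (2 * l))"
    using mult_mono[OF l1 l3] l1 lnx by (simp add: mult.left_commute)
  also have "\<dots> \<le> (5 * l)\<^sup>2" by (simp add: power2_eq_square)
  finally show ?thesis
    unfolding l_def[symmetric] using l1 by (intro real_le_lsqrt) auto
qed

section \<open>Travelling perturbations of the balanced state\<close>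

text \<open>\<open>S\<close> is the orbit of \<open>x\<close> and its size is the first return time,
  so the iterates before the return list \<open>S\<close> without repetition. Hence sending as many
  tokens as there are outgoing arcs uses each arc once and restores the pointer.\<close>

lemma cyclic_on_funpow_card:
  assumes "cyclic_on f S" "x \<in> S"
  shows funpow_card_cyclic_on: "(f ^^ card S) x = x"
    and card_funpow_eq_cyclic_on: "y \<in> S \<Longrightarrow> card {i. i < card S \<and> (f ^^ i) x = y} = 1"
proof -
  have S: "S = orbit f x" using assms by (simp add: orbit_cyclic_eq3)
  then have xo: "x \<in> orbit f x" using assms by simp
  define d where "d = funpow_dist1 f x x"
  have im: "S = (\<lambda>n. (f ^^ n) x) ` {0..<d}" unfolding S d_def using xo by (rule orbit_conv_funpow_dist1)
  have inj: "inj_on (\<lambda>n. (f ^^ n) x) {0..<d}" unfolding d_def using xo by (rule inj_on_funpow_dist1)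
  have d: "card S = d" unfolding im using inj by (simp add: card_image)
  show "(f ^^ card S) x = x" unfolding d unfolding d_def using xo by (rule funpow_dist1_prop)
  assume "y \<in> S"
  then obtain i where i: "i < d" "(f ^^ i) x = y" using im by auto
  have "{i. i < card S \<and> (f ^^ i) x = y} = {i}"
    using i inj unfolding d by (auto dest: inj_onD)
  then show "card {i. i < card S \<and> (f ^^ i) x = y} = 1" by simp
qed

text \<open>The successor modulo \<open>n\<close> is carried over to \<open>S\<close> along a
  bijection with \<open>{0..<n}\<close>.\<close>

lemma cyclic_on_exists:
  assumes "finite S" "S \<noteq> {}"
  shows "\<exists>f. cyclic_on f S"
proof -
  define n where "n = card S"
  have n: "n > 0" using assms by (simp add: n_def card_gt_0_iff)
  obtain h where h: "bij_betw h {0..<n} S"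
    using ex_bij_betw_nat_finite[OF assms(1)] n_def by blast
  have pow: "((\<lambda>i. Suc i mod n) ^^ k) 0 = k mod n" for k
    by (induction k) (auto simp: mod_Suc_eq)
  have "{0..<n} = orbit (\<lambda>i. Suc i mod n) 0"
  proof -
    have "orbit (\<lambda>i. Suc i mod n) 0 = {((\<lambda>i. Suc i mod n) ^^ m) 0 | m. m < n}"
      using n by (intro orbit_altdef_bounded) (auto simp: pow)
    also have "\<dots> = {0..<n}" by (auto simp: pow) (metis mod_less)
    finally show ?thesis by simp
  qed
  moreover have "0 \<in> {0..<n}" using n by simp
  ultimately have cyc: "cyclic_on (\<lambda>i. Suc i mod n) {0..<n}" by (rule cyclic_on_singleI[rotated])
  have "cyclic_on (\<lambda>e. h (Suc (inv_into {0..<n} h e) mod n)) (h ` {0..<n})"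
    using cyc by (rule cyclic_on_image) (use h in \<open>auto simp: bij_betw_def\<close>)
  moreover have "h ` {0..<n} = S" using h by (rule bij_betw_imp_surj_on)
  ultimately show ?thesis by metis
qed

section \<open>Arcs and degrees\<close>

lemma arcs_bidirect [simp]: "arcs (bidirect V E) = {(u, v). {u, v} \<in> E}"
  and verts_bidirect [simp]: "verts (bidirect V E) = V"
  and tail_bidirect [simp]: "tail (bidirect V E) = fst"
  and head_bidirect [simp]: "head (bidirect V E) = snd"
  by (simp_all add: bidirect_def with_proj_def)

context rotor_router
begin

lemma edge_endpoints:
  assumes "{u, v} \<in> E" shows "u \<in> V" "v \<in> V" "u \<noteq> v"
proof -
  obtain a b where "{u, v} = {a, b}" "a \<in> V" "b \<in> V" "a \<noteq> b" using assms E_edges by auto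
  then show "u \<in> V" "v \<in> V" "u \<noteq> v" by (auto simp: doubleton_eq_iff)
qed

lemma finite_out: "finite (out v)"
proof -
  have "out v \<subseteq> V \<times> V" by (auto dest: edge_endpoints)
  then show ?thesis using finite_V finite_subset by blast
qed

lemma card_in_arcs: "card (in_arcs (bidirect V E) v) = card (out v)"
proof (rule bij_betw_same_card)
  show "bij_betw prod.swap (in_arcs (bidirect V E) v) (out v)"
    by (rule bij_betwI[where g = prod.swap]) (auto simp: insert_commute)
qed

lemma finite_in_arcs: "finite (in_arcs (bidirect V E) v)"
proof -
  have "in_arcs (bidirect V E) v \<subseteq> V \<times> V" by (auto dest: edge_endpoints)
  then show ?thesis using finite_V finite_subset by blast
qed

text \<open>Arcs are grouped by tail and then by underlying edge; the endpoints of an edge are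
  distinct, so each edge carries two arcs.\<close>

lemma sum_card_out: "(\<Sum>v\<in>V. card (out v)) = 2 * card E"
proof -
  have fE: "finite E"
  proof (rule finite_subset)
    show "E \<subseteq> (\<lambda>(u,v). {u,v}) ` (V \<times> V)" using E_edges by auto
  qed (use finite_V in auto)
  have "(\<Sum>v\<in>V. card (out v)) = card (\<Union>v\<in>V. out v)"
    using finite_V finite_out by (intro card_UN_disjoint[symmetric]) auto
  also have "(\<Union>v\<in>V. out v) = (\<Union>e\<in>E. {(u, v). {u, v} = e})"
    by (auto dest: edge_endpoints)
  also have "card \<dots> = (\<Sum>e\<in>E. card {(u, v). {u, v} = e})"
  proof (intro card_UN_disjoint fE ballI impI)
    fix e assume "e \<in> E"
    then obtain u v where e: "e = {u, v}" using E_edges by auto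
    have "{(u, v). {u, v} = e} \<subseteq> {(u, v), (v, u)}" by (auto simp: e doubleton_eq_iff)
    then show "finite {(u, v). {u, v} = e}" by (rule finite_subset) auto
  qed auto
  also have "\<dots> = (\<Sum>e\<in>E. 2)"
  proof (intro sum.cong refl)
    fix e assume "e \<in> E"
    then obtain u v where e: "e = {u, v}" "u \<noteq> v" using E_edges by auto
    have "{(u, v). {u, v} = e} = {(u, v), (v, u)}" by (auto simp: e doubleton_eq_iff)
    then show "card {(u, v). {u, v} = e} = 2" using e(2) by simp
  qed
  finally show ?thesis by simp
qed

text \<open>
  Every vertex \<open>v\<close> has one token per outgoing arc, up to an extra token at the vertices
  \<open>snd (b v)\<close>, \<open>v \<in> H\<close>, and a missing one at the vertices of \<open>H\<close>. The extra token advances the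
  pointer of its vertex by one, and the missing token one step later moves it back.
  The truncated subtraction is harmless, as degrees are positive.
\<close>

definition wave_state :: "('a \<Rightarrow> 'a \<times> 'a) \<Rightarrow> 'a set \<Rightarrow> 'a state" where
  "wave_state b H =
    \<lparr> pointer = (\<lambda>v\<in>V. if v \<in> H then nxt (b v) else b v),
      tokens = (\<lambda>v\<in>V. card (out v) + of_bool (v \<in> (snd \<circ> b) ` H) - of_bool (v \<in> H)) \<rparr>"

lemma card_out_pos:
  assumes "v \<in> V" shows "card (out v) > 0"
  using nxt_cyclic[OF assms] finite_out[of v] by (auto simp: card_gt_0_iff cyclic_on_def)

text \<open>The additive form frees later counts from truncated subtraction.\<close>

lemma tokens_wave_state:
  assumes "v \<in> V"
  shows "tokens (wave_state b H) v + of_bool (v \<in> H) = card (out v) + of_bool (v \<in> (snd \<circ> b) ` H)"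
  using card_out_pos[OF assms] assms by (auto simp: wave_state_def)

text \<open>A full turn of the pointer uses every arc once. A surplus token repeats the starting arc
  \<open>b v\<close>; with a token missing, the turn starts at \<open>nxt (b v)\<close> and stops
  just short of \<open>b v\<close>. If both occur at \<open>v\<close>, the corrections
  cancel.\<close>

lemma sent_wave_state:
  assumes b: "\<And>v. v \<in> V \<Longrightarrow> b v \<in> out v" and e: "e \<in> out v" "v \<in> V"
  shows "sent (wave_state b H) e + of_bool (v \<in> H \<and> e = b v)
       = 1 + of_bool (v \<in> (snd \<circ> b) ` H \<and> e = b v)"
proof -
  let ?d = "card (out v)" and ?S = "wave_state b H"
  note cyc = nxt_cyclic[OF e(2)]
  have d: "?d > 0" using card_out_pos[OF e(2)] .
  have [simp]: "fst e = v" using e by auto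
  have base: "card {i. i < ?d \<and> (nxt ^^ i) x = e} = 1" if "x \<in> out v" for x
    using card_funpow_eq_cyclic_on[OF cyc that e(1)] .
  have next_in: "nxt (b v) \<in> out v" using cyclic_on_inI[OF cyc b[OF e(2)]] .
  have upper: "card {i. i < Suc ?d \<and> (nxt ^^ i) (b v) = e} = 1 + of_bool (e = b v)"
  proof -
    have "{i. i < Suc ?d \<and> (nxt ^^ i) (b v) = e}
        = {i. i < ?d \<and> (nxt ^^ i) (b v) = e} \<union> (if e = b v then {?d} else {})"
      using funpow_card_cyclic_on[OF cyc b[OF e(2)]] by (auto simp: less_Suc_eq)
    moreover have "card \<dots> = 1 + of_bool (e = b v)"
      using base[OF b[OF e(2)]] by (subst card_Un_disjoint) auto
    ultimately show ?thesis by simp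
  qed
  have lower: "card {i. i < ?d - 1 \<and> (nxt ^^ i) (nxt (b v)) = e} + of_bool (e = b v) = 1"
  proof -
    have "{i. i < ?d \<and> (nxt ^^ i) (nxt (b v)) = e}
        = {i. i < ?d - 1 \<and> (nxt ^^ i) (nxt (b v)) = e} \<union> (if e = b v then {?d - 1} else {})"
    proof -
      have "(nxt ^^ (?d - 1)) (nxt (b v)) = b v"
        using funpow_card_cyclic_on[OF cyc b[OF e(2)]] d
        by (metis Suc_diff_1 comp_apply funpow_Suc_right)
      moreover have "i < ?d \<longleftrightarrow> i < ?d - 1 \<or> i = ?d - 1" for i using d by linarith
      ultimately show ?thesis by auto
    qed
    moreover have "card \<dots> = card {i. i < ?d - 1 \<and> (nxt ^^ i) (nxt (b v)) = e} + of_bool (e = b v)"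
      by (subst card_Un_disjoint) auto
    ultimately show ?thesis using base[OF next_in] by simp
  qed
  show ?thesis
    using upper lower base[OF next_in] base[OF b[OF e(2)]] e(2)
    by (auto simp: sent_def wave_state_def)
qed

text \<open>Only the arcs \<open>b u\<close> carry more or less than one token, so surplus and
  deficit both move along \<open>snd \<circ> b\<close>. The pointer advanced by a surplus is the one
  required at that vertex when the deficit arrives.\<close>

lemma step_wave_state:
  assumes b: "\<And>v. v \<in> V \<Longrightarrow> b v \<in> out v"
    and W: "W \<subseteq> V" "inj_on (snd \<circ> b) W" "(snd \<circ> b) ` W \<subseteq> W" and H: "H \<subseteq> W"
  shows "step (wave_state b H) = wave_state b ((snd \<circ> b) ` H)"
proof -
  let ?s = "snd \<circ> b" and ?S = "wave_state b H"
  have fstb: "fst (b v) = v" if "v \<in> V" for v using b[OF that] by auto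
  have sH: "?s ` H \<subseteq> W" using W H by blast
  have ptr: "(nxt ^^ tokens ?S v) (pointer ?S v) = (if v \<in> ?s ` H then nxt (b v) else b v)" if v: "v \<in> V" for v
  proof -
    have d: "card (out v) > 0" using card_out_pos[OF v] .
    have full: "(nxt ^^ card (out v)) x = x" if "x \<in> out v" for x
      using funpow_card_cyclic_on[OF nxt_cyclic[OF v] that] .
    have n: "nxt (b v) \<in> out v" using cyclic_on_inI[OF nxt_cyclic[OF v] b[OF v]] .
    have "(nxt ^^ (card (out v) - 1)) (nxt (b v)) = b v"
      using full[OF b[OF v]] d by (metis Suc_diff_1 comp_apply funpow_Suc_right)
    moreover have "(nxt ^^ Suc (card (out v))) (b v) = nxt (b v)" using full[OF b[OF v]] by simp
    ultimately show ?thesis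
      using v full[OF b[OF v]] full[OF n] by (auto simp: wave_state_def)
  qed
  \<comment> \<open>At most one deviating arc enters \<open>v\<close>, by injectivity of
    \<open>snd \<circ> b\<close>. This serves for the deficits, with \<open>A = H\<close>, and for
    the surpluses, with \<open>A\<close> the image of \<open>H\<close>.\<close>
  have count: "(\<Sum>e\<in>in_arcs (bidirect V E) v. of_bool (fst e \<in> A \<and> e = b (fst e))) = (of_bool (v \<in> ?s ` A) :: nat)"
    if A: "A \<subseteq> W" and v: "v \<in> V" for A v
  proof -
    have "(\<Sum>e\<in>in_arcs (bidirect V E) v. of_bool (fst e \<in> A \<and> e = b (fst e))) =
      card (in_arcs (bidirect V E) v \<inter> {e. fst e \<in> A \<and> e = b (fst e)})"
      using finite_in_arcs by (simp add: sum_of_bool_eq)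
    also have "in_arcs (bidirect V E) v \<inter> {e. fst e \<in> A \<and> e = b (fst e)} = b ` {u \<in> A. ?s u = v}"
    proof (intro set_eqI iffI)
      fix e assume "e \<in> in_arcs (bidirect V E) v \<inter> {e. fst e \<in> A \<and> e = b (fst e)}"
      then show "e \<in> b ` {u \<in> A. ?s u = v}" by (intro image_eqI[of e b "fst e"]) auto
    next
      fix e assume "e \<in> b ` {u \<in> A. ?s u = v}"
      then obtain u where u: "u \<in> A" "?s u = v" "e = b u" by auto
      then have "u \<in> V" using A W by blast
      then have "e \<in> out u" using b u by simp
      then show "e \<in> in_arcs (bidirect V E) v \<inter> {e. fst e \<in> A \<and> e = b (fst e)}" using u by auto
    qed
    also have "card \<dots> = card {u \<in> A. ?s u = v}"
      using fstb A W by (intro card_image inj_onI) (metis (no_types, lifting) mem_Collect_eq subsetD)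
    also have "\<dots> = of_bool (v \<in> ?s ` A)"
    proof (cases "v \<in> ?s ` A")
      case True
      then obtain u where u: "u \<in> A" "?s u = v" by auto
      have "inj_on ?s A" using W A by (blast intro: inj_on_subset)
      then have "{u \<in> A. ?s u = v} = {u}" using u by (auto simp: inj_on_def)
      then show ?thesis using True by simp
    next
      case False
      then have none: "{u \<in> A. ?s u = v} = {}" by auto
      show ?thesis unfolding none using False by simp
    qed
    finally show ?thesis .
  qed
  have tok: "(\<Sum>e\<in>in_arcs (bidirect V E) v. sent ?S e) = tokens (wave_state b (?s ` H)) v" if v: "v \<in> V" for v
  proof -
    let ?I = "in_arcs (bidirect V E) v"
    have "(\<Sum>e\<in>?I. sent ?S e) + (\<Sum>e\<in>?I. of_bool (fst e \<in> H \<and> e = b (fst e)))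
      = (\<Sum>e\<in>?I. sent ?S e + of_bool (fst e \<in> H \<and> e = b (fst e)))" by (simp only: sum.distrib)
    also have "\<dots> = (\<Sum>e\<in>?I. 1 + of_bool (fst e \<in> ?s ` H \<and> e = b (fst e)))"
    proof (intro sum.cong refl sent_wave_state b)
      fix e assume "e \<in> ?I"
      then have "{fst e, snd e} \<in> E" by auto
      then show "e \<in> out (fst e)" "fst e \<in> V" by (auto dest: edge_endpoints)
    qed
    also have "\<dots> = card (out v) + of_bool (v \<in> ?s ` ?s ` H)"
      unfolding sum.distrib count[OF sH v] by (simp add: card_in_arcs)
    finally have "(\<Sum>e\<in>?I. sent ?S e) + of_bool (v \<in> ?s ` H) = card (out v) + of_bool (v \<in> ?s ` ?s ` H)"
      unfolding count[OF H v] .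
    then show ?thesis using tokens_wave_state[OF v, of b "?s ` H"] by linarith
  qed
  show ?thesis
    using ptr tok unfolding step_def by (auto simp: wave_state_def fun_eq_iff)
qed

lemma wave_state_in_states:
  assumes b: "\<And>v. v \<in> V \<Longrightarrow> b v \<in> out v"
  shows "wave_state b H \<in> states"
proof -
  have "nxt (b v) \<in> out v" if "v \<in> V" for v
    using cyclic_on_inI[OF nxt_cyclic[OF that] b[OF that]] .
  then show ?thesis using b by (auto simp: states_def wave_state_def PiE_iff)
qed

text \<open>By injectivity there are as many surpluses as deficits, so the total is the sum of all
  degrees.\<close>

lemma total_tokens_wave_state:
  assumes W: "W \<subseteq> V" "inj_on (snd \<circ> b) W" "(snd \<circ> b) ` W \<subseteq> W" and H: "H \<subseteq> W"
  shows "total_tokens (wave_state b H) = 2 * card E"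
proof -
  have "total_tokens (wave_state b H) + (\<Sum>v\<in>V. of_bool (v \<in> H)) =
      (\<Sum>v\<in>V. tokens (wave_state b H) v + of_bool (v \<in> H))"
    by (simp add: total_tokens_def sum.distrib)
  also have "\<dots> = (\<Sum>v\<in>V. card (out v)) + (\<Sum>v\<in>V. of_bool (v \<in> (snd \<circ> b) ` H))"
    by (simp add: tokens_wave_state sum.distrib)
  finally have *: "total_tokens (wave_state b H) + (\<Sum>v\<in>V. of_bool (v \<in> H)) =
    2 * card E + (\<Sum>v\<in>V. of_bool (v \<in> (snd \<circ> b) ` H))" by (simp add: sum_card_out)
  have count: "(\<Sum>v\<in>V. of_bool (v \<in> A)) = card A" if "A \<subseteq> V" for A
    using that finite_V by (simp add: sum_of_bool_eq Int_absorb1)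
  have "card ((snd \<circ> b) ` H) = card H" using W H by (intro card_image) (rule inj_on_subset)
  moreover have "(snd \<circ> b) ` H \<subseteq> V" using W H by blast
  moreover have "H \<subseteq> V" using W H by blast
  ultimately show ?thesis using * count by simp
qed

lemma state_at_wave_state:
  assumes b: "\<And>v. v \<in> V \<Longrightarrow> b v \<in> out v"
    and W: "W \<subseteq> V" "inj_on (snd \<circ> b) W" "(snd \<circ> b) ` W \<subseteq> W" and H: "H \<subseteq> W"
  shows "state_at (wave_state b H) t = wave_state b (((snd \<circ> b) ^^ t) ` H)"
proof (induction t)
  case (Suc t)
  have "((snd \<circ> b) ^^ t) ` H \<subseteq> W"
  proof (induction t)
    case (Suc t)
    then have "(snd \<circ> b) ` ((snd \<circ> b) ^^ t) ` H \<subseteq> W" using W by blast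
    then show ?case unfolding image_comp funpow.simps(2) .
  qed (use H in simp)
  from step_wave_state[OF b W this] Suc show ?case
    unfolding state_at_def image_comp funpow.simps(2) comp_apply[of step] by (simp only:)
qed (simp add: state_at_def)

text \<open>The pointers alone reveal the set, since \<open>nxt\<close> fixes \<open>b v\<close>
  only if \<open>v\<close> has a single outgoing arc.\<close>

lemma wave_state_inject:
  assumes b: "\<And>v. v \<in> V \<Longrightarrow> b v \<in> out v" and H: "H \<subseteq> V" "H' \<subseteq> V"
    and deg: "\<And>v. v \<in> H \<union> H' \<Longrightarrow> card (out v) \<noteq> 1"
    and eq: "wave_state b H = wave_state b H'"
  shows "H = H'"
proof (intro set_eqI)
  fix v
  show "v \<in> H \<longleftrightarrow> v \<in> H'"
  proof (cases "v \<in> H \<union> H'")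
    case True
    then have v: "v \<in> V" using H by auto
    have "nxt (b v) \<noteq> b v"
      using eq_on_cyclic_on_iff1[OF nxt_cyclic[OF v] b[OF v]] deg[OF True] by auto
    moreover have "pointer (wave_state b H) v = pointer (wave_state b H') v" using eq by simp
    ultimately show ?thesis using v by (auto simp: wave_state_def split: if_splits)
  qed auto
qed

section \<open>Return times of recurrent states\<close>

text \<open>A return to the initial state makes time 0 stable, so the periodicity of such a state is
  its least positive return time.\<close>

lemma stabilization_time_eq_0:
  assumes "t > 0" "state_at S t = S"
  shows "stabilization_time S = 0"
  unfolding stabilization_time_def using assms by (intro Least_eq_0) (auto simp: stable_def state_at_def)

lemma periodicity_recurrent:
  assumes "t > 0" "state_at S t = S"
  shows "periodicity S > 0" "state_at S (periodicity S) = S"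
proof -
  have "periodicity S > 0 \<and> state_at S 0 = state_at S (0 + periodicity S)"
    unfolding periodicity_def stabilization_time_eq_0[OF assms]
    by (rule LeastI[of _ t]) (use assms in \<open>auto simp: state_at_def\<close>)
  then show "periodicity S > 0" "state_at S (periodicity S) = S" by (auto simp: state_at_def)
qed

end

section \<open>Joining cycles by a hub\<close>

text \<open>The spokes make the graph connected and give every vertex of \<open>W\<close> a second
  outgoing arc, so a state determines its deficit set. A return of the state is therefore a return
  of \<open>H\<close> under \<open>s\<close>.\<close>

lemma hub_rotor_router:
  fixes W :: "'a set" and h :: 'a and s :: "'a \<Rightarrow> 'a"
  defines "E \<equiv> (\<lambda>v. {v, s v}) ` W \<union> (\<lambda>v. {h, v}) ` W"
  assumes W: "finite W" and h: "h \<notin> W" and s: "inj_on s W" "s ` insert h W \<subseteq> W"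
    and no_fix: "\<And>v. v \<in> W \<Longrightarrow> s v \<noteq> v"
    and H: "H \<subseteq> W" and N: "N > 0" "(s ^^ N) ` H = H"
  obtains nxt S where "rotor_router (insert h W) E nxt"
    and "S \<in> rotor_router.states (insert h W) E"
    and "rotor_router.total_tokens (insert h W) S = 2 * card E"
    and "rotor_router.periodicity (insert h W) E nxt S > 0"
    and "(s ^^ rotor_router.periodicity (insert h W) E nxt S) ` H = H"
proof -
  let ?V = "insert h W"
  \<comment> \<open>Any port ordering will do; one is chosen per vertex, selected by the tail of the
    arc.\<close>
  define nxt where "nxt e = (SOME f. cyclic_on f (out_arcs (bidirect ?V E) (fst e))) e" for e
  have endpoints: "u \<in> ?V \<and> v \<in> ?V \<and> u \<noteq> v" if "{u, v} \<in> E" for u v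
  proof -
    from that consider w where "w \<in> W" "{u, v} = {w, s w}" | w where "w \<in> W" "{u, v} = {h, w}"
      by (auto simp: E_def)
    then show ?thesis
    proof cases
      case 1
      then have "s w \<in> W" "s w \<noteq> w" using s(2) no_fix by auto
      then show ?thesis using 1 by (auto simp: doubleton_eq_iff)
    next
      case 2
      then show ?thesis using h by (auto simp: doubleton_eq_iff)
    qed
  qed
  \<comment> \<open>For \<open>v = h\<close> this arc is a spoke, because \<open>s h\<close> lies in
    \<open>W\<close>.\<close>
  have base: "(v, s v) \<in> out_arcs (bidirect ?V E) v" if "v \<in> ?V" for v
    using that s(2) by (auto simp: E_def)
  have spoke: "(v, h) \<in> out_arcs (bidirect ?V E) v" if "v \<in> W" for v
    using that by (auto simp: E_def insert_commute)
  have fin: "finite (out_arcs (bidirect ?V E) v)" for v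
  proof (rule finite_subset)
    show "out_arcs (bidirect ?V E) v \<subseteq> ?V \<times> ?V" by (auto dest: endpoints)
  qed (use W in auto)
  interpret rotor_router ?V E nxt
  proof
    show "finite ?V" using W by simp
    show "E \<subseteq> {{u, v} |u v. u \<in> ?V \<and> v \<in> ?V \<and> u \<noteq> v}"
    proof
      fix e assume e: "e \<in> E"
      then obtain u v where "e = {u, v}" by (auto simp: E_def)
      then show "e \<in> {{u, v} |u v. u \<in> ?V \<and> v \<in> ?V \<and> u \<noteq> v}" using endpoints e by blast
    qed
    show "connected (bidirect ?V E)"
      unfolding connected_conv verts_bidirect
    proof (intro conjI ballI)
      let ?R = "(arcs_ends (bidirect ?V E))\<^sup>s"
      have to_hub: "(u, h) \<in> rtrancl_on ?V ?R" and from_hub: "(h, u) \<in> rtrancl_on ?V ?R"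
        if u: "u \<in> ?V" for u
      proof -
        have "(u, h) \<in> rtrancl_on ?V ?R \<and> (h, u) \<in> rtrancl_on ?V ?R"
        proof (cases "u = h")
          case False
          then have "(u, h) \<in> ?R" "(h, u) \<in> ?R"
            using u spoke[of u] by (force simp: symcl_def arcs_ends_conv insert_commute)+
          then show ?thesis
            using u by (blast intro: rtrancl_on_into_rtrancl_on rtrancl_on_refl)
        qed simp
        then show "(u, h) \<in> rtrancl_on ?V ?R" "(h, u) \<in> rtrancl_on ?V ?R" by auto
      qed
      fix u v assume "u \<in> ?V" "v \<in> ?V"
      then show "(u, v) \<in> rtrancl_on ?V ?R" by (intro rtrancl_on_trans[OF to_hub from_hub])
    qed simp
    fix v assume v: "v \<in> ?V"
    define f where "f = (SOME f. cyclic_on f (out_arcs (bidirect ?V E) v))"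
    have "cyclic_on f (out_arcs (bidirect ?V E) v)"
      unfolding f_def using base[OF v] by (intro someI_ex[OF cyclic_on_exists] fin) blast
    moreover have "nxt e = f e" if "e \<in> out_arcs (bidirect ?V E) v" for e
      using that by (auto simp: nxt_def f_def)
    ultimately show "cyclic_on nxt (out_arcs (bidirect ?V E) v)"
      using cyclic_cong[of "out_arcs (bidirect ?V E) v" nxt f] by blast
  qed
  define b where "b v = (v, s v)" for v
  have snd_b: "snd \<circ> b = s" by (auto simp: b_def)
  have b: "b v \<in> out v" if "v \<in> ?V" for v using base[OF that] by (simp only: b_def)
  have W': "W \<subseteq> ?V" "inj_on (snd \<circ> b) W" "(snd \<circ> b) ` W \<subseteq> W" using s by (auto simp: snd_b)
  define S where "S = wave_state b H"
  note state_at = state_at_wave_state[OF b W' H, folded S_def, unfolded snd_b]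
  have rec: "state_at S N = S" using state_at[of N] N by (simp add: S_def)
  define P where "P = periodicity S"
  have P: "P > 0" "state_at S P = S" using periodicity_recurrent[OF N(1) rec] by (auto simp: P_def)
  have sub: "(s ^^ P) ` H \<subseteq> W"
  proof (induction P)
    case (Suc n)
    have "(s ^^ Suc n) ` H = s ` (s ^^ n) ` H" by (simp add: image_comp comp_def)
    then show ?case using Suc s(2) by blast
  qed (use H in simp)
  have "(s ^^ P) ` H = H"
  proof (rule wave_state_inject[of b])
    show "wave_state b ((s ^^ P) ` H) = wave_state b H" using P(2) state_at[of P] by (simp add: S_def)
    fix v assume "v \<in> (s ^^ P) ` H \<union> H"
    then have v: "v \<in> W" using sub H by blast
    \<comment> \<open>The cycle arc and the spoke at \<open>v\<close> differ because
      \<open>s v\<close> lies in \<open>W\<close> and \<open>h\<close> does not.\<close>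
    have "(v, s v) \<in> out v" "(v, h) \<in> out v" using base[of v] spoke[of v] v by blast+
    moreover have "(v, s v) \<noteq> (v, h)" using v s(2) h by auto
    ultimately show "card (out v) \<noteq> 1" by (metis card_1_singletonE singletonD)
  qed (use b sub H in blast)+
  moreover have "S \<in> states" unfolding S_def using b by (rule wave_state_in_states)
  moreover have "total_tokens S = 2 * card E" unfolding S_def by (rule total_tokens_wave_state[OF W' H])
  ultimately show ?thesis
    using that[OF rotor_router_axioms] P(1) unfolding P_def by blast
qed

text \<open>Vertex \<open>j\<close> of cycle \<open>p\<close> is \<open>c p j\<close>, and each
  cycle has one deficit, starting at \<open>j = 0\<close>. Deficits never change cycles, so each
  must complete whole turns before the state recurs.\<close>

lemma cycles_rotor_router:
  fixes I :: "nat set" and q :: "nat \<Rightarrow> nat"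
  assumes I: "finite I" "I \<noteq> {}" and q: "\<And>p. p \<in> I \<Longrightarrow> q p \<ge> 2"
  obtains V E nxt S where "rotor_router (V :: nat set) E nxt"
    and "S \<in> rotor_router.states V E"
    and "rotor_router.total_tokens V S = 2 * card E"
    and "card V = Suc (\<Sum>p\<in>I. q p)"
    and "rotor_router.periodicity V E nxt S > 0"
    and "\<forall>p\<in>I. q p dvd rotor_router.periodicity V E nxt S"
proof -
  \<comment> \<open>The successor keeps 0 free for the hub.\<close>
  define c where "c p j = Suc (prod_encode (p, j))" for p j
  have c_eq: "c p j = c p' j' \<longleftrightarrow> p = p' \<and> j = j'" for p j p' j' by (simp add: c_def)
  obtain p0 where p0: "p0 \<in> I" using I by auto
  \<comment> \<open>The value at the hub 0 only has to be some vertex of \<open>W\<close>, to fix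
    the hub's pointer.\<close>
  define s where "s v = (if v = 0 then c p0 0 else
    (case prod_decode (v - 1) of (p, j) \<Rightarrow> c p (Suc j mod q p)))" for v
  have s_c: "s (c p j) = c p (Suc j mod q p)" for p j by (simp add: s_def c_def)
  define W where "W = (\<lambda>(p, j). c p j) ` (SIGMA p:I. {..<q p})"
  have W: "w \<in> W \<longleftrightarrow> (\<exists>p j. w = c p j \<and> p \<in> I \<and> j < q p)" for w by (auto simp: W_def)
  define H where "H = (\<lambda>p. c p 0) ` I"
  have pow: "(s ^^ t) (c p 0) = c p (t mod q p)" for t p
    by (induction t) (auto simp: s_c mod_Suc_eq)
  have qpos: "q p > 0" if "p \<in> I" for p using q[OF that] by simp
  have "finite W" using I by (auto simp: W_def)
  moreover have "0 \<notin> W" by (auto simp: W c_def)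
  moreover have "inj_on s W"
  proof (intro inj_onI)
    fix v w assume "v \<in> W" "w \<in> W" and eq: "s v = s w"
    then obtain p j p' j' where v: "v = c p j" "j < q p" and w: "w = c p' j'" "j' < q p'"
      by (auto simp: W)
    have "p = p'" "Suc j mod q p = Suc j' mod q p" using eq by (auto simp: v w s_c c_eq)
    then have "j = j'" using v(2) w(2) by (auto simp: mod_Suc split: if_splits)
    then show "v = w" using v w \<open>p = p'\<close> by simp
  qed
  moreover have "s ` insert 0 W \<subseteq> W"
  proof
    fix w assume "w \<in> s ` insert 0 W"
    then consider "w = s 0" | p j where "w = s (c p j)" "p \<in> I" by (auto simp: W)
    then show "w \<in> W" using p0 qpos by cases (auto simp: W s_c c_eq s_def[of 0])
  qed
  \<comment> \<open>Length at least 2 excludes loops; a cycle of length 2 runs along both arcs of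
    one edge.\<close>
  moreover have "s v \<noteq> v" if "v \<in> W" for v
  proof -
    from that obtain p j where v: "v = c p j" "p \<in> I" "j < q p" by (auto simp: W)
    have "Suc j mod q p \<noteq> j" using v(3) q[OF v(2)] by (auto simp: mod_Suc)
    then show ?thesis by (simp add: v s_c c_eq)
  qed
  moreover have "H \<subseteq> W" using qpos unfolding H_def W_def by force
  \<comment> \<open>The product of the lengths is a convenient common return time; it need not be
    the least.\<close>
  moreover have "(\<Prod>p\<in>I. q p) > 0" using qpos by (intro prod_pos) auto
  moreover have "(s ^^ (\<Prod>p\<in>I. q p)) ` H = H"
  proof -
    have "(s ^^ (\<Prod>p\<in>I. q p)) (c p 0) = c p 0" if "p \<in> I" for p
      using dvd_prodI[OF I(1) that, of q] by (simp add: pow)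
    then show ?thesis by (simp add: H_def image_image)
  qed
  ultimately obtain nxt S E where *: "rotor_router (insert 0 W) E nxt"
    "S \<in> rotor_router.states (insert 0 W) E"
    "rotor_router.total_tokens (insert 0 W) S = 2 * card E"
    "rotor_router.periodicity (insert 0 W) E nxt S > 0"
    "(s ^^ rotor_router.periodicity (insert 0 W) E nxt S) ` H = H"
    by (rule hub_rotor_router)
  have "card W = (\<Sum>p\<in>I. q p)"
    unfolding W_def using I by (subst card_image) (auto simp: inj_on_def c_eq)
  then have "card (insert 0 W) = Suc (\<Sum>p\<in>I. q p)" using \<open>finite W\<close> \<open>0 \<notin> W\<close> by simp
  moreover have "q p dvd rotor_router.periodicity (insert 0 W) E nxt S" if p: "p \<in> I" for p
  proof -
    let ?P = "rotor_router.periodicity (insert 0 W) E nxt S"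
    \<comment> \<open>The only element of \<open>H\<close> on cycle \<open>p\<close> is
      \<open>c p 0\<close> itself.\<close>
    have "(s ^^ ?P) (c p 0) \<in> H" using *(5) p by (metis H_def imageI)
    then have "?P mod q p = 0" by (auto simp: pow H_def c_eq)
    then show ?thesis by auto
  qed
  ultimately show ?thesis using that *(1-4) by blast
qed

section \<open>The infinite family\<close>

theorem theorem1:
  shows "\<exists>(V :: nat \<Rightarrow> nat set) (E :: nat \<Rightarrow> nat set set)
            (nxt :: nat \<Rightarrow> nat \<times> nat \<Rightarrow> nat \<times> nat) (S0 :: nat \<Rightarrow> nat state).
      (\<forall>i. rotor_router (V i) (E i) (nxt i)
         \<and> S0 i \<in> rotor_router.states (V i) (E i)
         \<and> rotor_router.total_tokens (V i) (S0 i) = 2 * card (E i))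
    \<and> filterlim (\<lambda>i. card (V i)) at_top sequentially
    \<and> (\<exists>f :: nat \<Rightarrow> real.
         f \<in> \<Omega>(\<lambda>i. sqrt (real (card (V i)) * ln (real (card (V i)))))
       \<and> (\<forall>i. real (rotor_router.periodicity (V i) (E i) (nxt i) (S0 i)) = 2 powr f i))"
proof -
  \<comment> \<open>The shift by 4 puts every index in the range of the logarithmic
    estimate.\<close>
  define I where "I i = {p. prime p \<and> p \<le> i + 4}" for i :: nat
  define size where "size i = Suc (\<Sum>p\<in>I i. lcm_prime_power (i + 4) p)" for i
  have "\<exists>V E nxt S. rotor_router (V :: nat set) E nxt
         \<and> S \<in> rotor_router.states V E
         \<and> rotor_router.total_tokens V S = 2 * card E
         \<and> card V = size i \<and> rotor_router.periodicity V E nxt S > 0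
         \<and> (\<forall>p\<in>I i. lcm_prime_power (i + 4) p dvd rotor_router.periodicity V E nxt S)" for i
  proof -
    have "finite (I i)" by (simp add: I_def)
    moreover have "2 \<in> I i" by (simp add: I_def)
    then have "I i \<noteq> {}" by blast
    moreover have "lcm_prime_power (i + 4) p \<ge> 2" if "p \<in> I i" for p
      using that lcm_prime_power_bounds(1)[of p "i + 4"] prime_ge_2_nat[of p] by (auto simp: I_def)
    ultimately obtain V E nxt S where "rotor_router (V :: nat set) E nxt"
      "S \<in> rotor_router.states V E" "rotor_router.total_tokens V S = 2 * card E"
      "card V = size i" "rotor_router.periodicity V E nxt S > 0"
      "\<forall>p\<in>I i. lcm_prime_power (i + 4) p dvd rotor_router.periodicity V E nxt S"
      unfolding size_def by (rule cycles_rotor_router[of "I i" "lcm_prime_power (i + 4)"])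
    then show ?thesis by blast
  qed
  then obtain V E nxt S where
    rr: "\<And>i. rotor_router (V i :: nat set) (E i) (nxt i) \<and> S i \<in> rotor_router.states (V i) (E i)
         \<and> rotor_router.total_tokens (V i) (S i) = 2 * card (E i)"
    and card_V: "\<And>i. card (V i) = size i"
    and pos: "\<And>i. rotor_router.periodicity (V i) (E i) (nxt i) (S i) > 0"
    and dvd: "\<And>i p. p \<in> I i \<Longrightarrow> lcm_prime_power (i + 4) p dvd rotor_router.periodicity (V i) (E i) (nxt i) (S i)"
    by metis
  define P where "P i = rotor_router.periodicity (V i) (E i) (nxt i) (S i)" for i
  have "Lcm {1..i + 4} dvd P i" for i
    using pos dvd by (intro Lcm_atLeastAtMost_dvdI) (auto simp: P_def I_def)
  then have "Lcm {1..i + 4} \<le> P i" for i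
    using pos by (intro dvd_imp_le) (auto simp: P_def)
  then have "log 2 (real (Lcm {1..i + 4})) \<le> log 2 (real (P i))" for i
    by (metis Lcm_atLeastAtMost_pos log_mono of_nat_0_less_iff of_nat_le_iff one_less_numeral_iff semiring_norm(76))
  moreover have "sqrt (real (size i) * ln (real (size i))) \<le> 5 * log 2 (real (Lcm {1..i + 4}))" for i
    by (rule log_Lcm_atLeastAtMost_ge) (simp_all add: size_def I_def)
  ultimately have bound: "sqrt (real (size i) * ln (real (size i))) \<le> 5 * log 2 (real (P i))" for i
    by (meson mult_left_mono order_trans zero_le_numeral)
  have "(\<lambda>i. log 2 (real (P i))) \<in> \<Omega>(\<lambda>i. sqrt (real (card (V i)) * ln (real (card (V i)))))"
  proof (rule landau_omega.bigI[of "1/5"])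
    show "\<forall>\<^sub>F i in sequentially. norm (log 2 (real (P i))) \<ge>
        1/5 * norm (sqrt (real (card (V i)) * ln (real (card (V i)))))"
    proof (intro always_eventually allI)
      fix i
      have "1 \<le> size i" by (simp add: size_def)
      then have "ln (real (size i)) \<ge> 0" by simp
      then show "norm (log 2 (real (P i))) \<ge>
        1/5 * norm (sqrt (real (card (V i)) * ln (real (card (V i)))))"
        using bound[of i] by (simp add: card_V)
    qed
  qed simp
  moreover have "real (P i) = 2 powr log 2 (real (P i))" for i
    using pos[of i] by (simp add: P_def)
  moreover have "filterlim (\<lambda>i. card (V i)) at_top sequentially"
    unfolding filterlim_at_top
  proof
    fix Z
    show "\<forall>\<^sub>F i in sequentially. Z \<le> card (V i)"
    proof (rule eventually_sequentiallyI)
      fix i assume "2 * Z \<le> i"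
      \<comment> \<open>The cycle for the prime 2 alone has more than \<open>(i + 4) / 2\<close>
        vertices, so the sizes are unbounded.\<close>
      moreover have "i + 4 < 2 * lcm_prime_power (i + 4) 2" by (intro lcm_prime_power_bounds) auto
      moreover have "lcm_prime_power (i + 4) 2 \<le> (\<Sum>p\<in>I i. lcm_prime_power (i + 4) p)"
        by (intro member_le_sum) (auto simp: I_def)
      ultimately show "Z \<le> card (V i)" by (simp add: card_V size_def)
    qed
  qed
  ultimately show ?thesis using rr unfolding P_def by blast
qed

end
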